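(* Let $m,n\ge 1$ be integers and let $B_{m,n}$ be the graph obtained by joining two disjoint complete graphs $K_m$ and $K_n$ with a bridge. Then $$\mathcal{L}(B_{m,n})=(m-1)!\,(n-1)!\left(\binom{m+n}{n+1}+\binom{m+n}{m+1}\right).$$
   Context: Let $H$ be a finite, connected, undirected graph with vertex set $V$. A random walk labeling of $H$ is a labeling of $V$ obtainable by the following process: (1) set $i=1$, choose any $v\in V$ and label $v$ with $i$; (2) as long as there are unlabeled vertices, choose a vertex $w$ adjacent to the current vertex $v$ and replace $v$ by $w$; if this new $v$ is not labeled, increase $i$ by $1$ and label $v$ with $i$. The number of different random walk labelings of $H$ is denoted by $\mathcal{L}(H)$. Joining two disjoint graphs with a bridge means adding a single edge between one vertex of the first and one vertex of the second. $B_{m,n}$ is thus the disjoint union of $K_m$ and $K_n$ together with one additional edge between a vertex of $K_m$ and a vertex of $K_n$ (the choice of these vertices is immaterial up to isomorphism). *)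

theory Defs
  imports Graph_Theory.Graph_Theory
begin

text \<open>
  Undirected graphs are symmetric digraphs, as in the locales \<^locale>\<open>graph\<close> and
  \<^locale>\<open>pair_graph\<close>. A state of the process consists of the current vertex, the partial
  labeling built so far and the last label used.
\<close>

inductive rw_process :: "('a, 'b) pre_digraph \<Rightarrow> 'a \<Rightarrow> ('a \<rightharpoonup> nat) \<Rightarrow> nat \<Rightarrow> bool"
  for H :: "('a, 'b) pre_digraph" where
  start: "v \<in> verts H \<Longrightarrow> rw_process H v [v \<mapsto> 1] 1"
| visit_new: "\<lbrakk>rw_process H v f i; \<not> verts H \<subseteq> dom f; v \<rightarrow>\<^bsub>H\<^esub> w; w \<notin> dom f\<rbrakk>
    \<Longrightarrow> rw_process H w (f(w \<mapsto> i + 1)) (i + 1)"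
| revisit: "\<lbrakk>rw_process H v f i; \<not> verts H \<subseteq> dom f; v \<rightarrow>\<^bsub>H\<^esub> w; w \<in> dom f\<rbrakk>
    \<Longrightarrow> rw_process H w f i"

definition rw_labelings :: "('a, 'b) pre_digraph \<Rightarrow> ('a \<rightharpoonup> nat) set" where
  "rw_labelings H = {f. dom f = verts H \<and> (\<exists>v i. rw_process H v f i)}"

definition num_rw_labelings :: "('a, 'b) pre_digraph \<Rightarrow> nat" where
  "num_rw_labelings H = card (rw_labelings H)"

text \<open>Being undirected, the bridge is a pair of opposite arcs.\<close>

definition bridge_join ::
  "'a pair_pre_digraph \<Rightarrow> 'a \<Rightarrow> 'a pair_pre_digraph \<Rightarrow> 'a \<Rightarrow> 'a pair_pre_digraph" where
  "bridge_join G u H v =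
     \<lparr> pverts = pverts G \<union> pverts H, parcs = parcs G \<union> parcs H \<union> {(u, v), (v, u)} \<rparr>"

lemma pair_graph_bridge_join:
  assumes "pair_graph G" "pair_graph H" "pverts G \<inter> pverts H = {}"
    and "u \<in> pverts G" "v \<in> pverts H"
  shows "pair_graph (bridge_join G u H v)"
proof -
  interpret G: pair_graph G by fact
  interpret H: pair_graph H by fact
  have sG: "sym (parcs G)" and sH: "sym (parcs H)"
    using G.pair_sym_arcs H.pair_sym_arcs by (simp_all add: symmetric_def)
  have "sym {(u, v), (v, u)}" by (auto simp: sym_def)
  then have "sym (parcs G \<union> parcs H \<union> {(u, v), (v, u)})" using sG sH by (intro sym_Un)
  moreover have "u \<noteq> v" using assms by auto
  ultimately show ?thesis
    using assms
    by unfold_locales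
      (auto simp: bridge_join_def symmetric_def G.in_arcsD1 G.in_arcsD2 H.in_arcsD1 H.in_arcsD2
        dest: G.pair_no_loops H.pair_no_loops
        G.arc_fst_in_verts G.arc_snd_in_verts H.arc_fst_in_verts H.arc_snd_in_verts)
qed

end

theory Submission
  imports Defs "HOL-Combinatorics.Multiset_Permutations"
begin

text \<open>
  A labeling amounts to the order in which the vertices are discovered, and an order occurs iff
  every vertex after the first has an earlier neighbour. For two cliques with vertex sets
  \<open>A\<close> and \<open>B\<close> joined by the bridge \<open>uv\<close>, the orders that start in \<open>A\<close> are the permutations of
  \<open>A \<union> B\<close> whose restriction to \<open>{u} \<union> B\<close> begins with \<open>u, v\<close>. Such a permutation is a shuffle of
  one of \<open>(|B| - 1)!\<close> admissible orders of \<open>{u} \<union> B\<close> with one of \<open>(|A| - 1)!\<close> orders of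
  \<open>A - {u}\<close>. The orders that start in \<open>B\<close> are counted symmetrically.
\<close>

section \<open>Discovery orders, their labelings, and the process that produces them\<close>

inductive search_order :: "('a, 'b) pre_digraph \<Rightarrow> 'a list \<Rightarrow> bool"
  for H :: "('a, 'b) pre_digraph" where
  start: "v \<in> verts H \<Longrightarrow> search_order H [v]"
| extend: "\<lbrakk>search_order H xs; x \<in> set xs; x \<rightarrow>\<^bsub>H\<^esub> w; w \<notin> set xs\<rbrakk> \<Longrightarrow> search_order H (xs @ [w])"

lemma search_order_distinct: "search_order H xs \<Longrightarrow> distinct xs"
  by (induction rule: search_order.induct) auto

definition labeling_of :: "'a list \<Rightarrow> 'a \<rightharpoonup> nat" where
  "labeling_of xs = map_of (zip xs [1..<Suc (length xs)])"

lemma dom_labeling_of [simp]: "dom (labeling_of xs) = set xs"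
  by (simp add: labeling_of_def del: upt_Suc)

lemma labeling_of_singleton: "labeling_of [v] = [v \<mapsto> 1]"
  by (simp add: labeling_of_def)

lemma labeling_of_snoc:
  assumes "w \<notin> set xs"
  shows "labeling_of (xs @ [w]) = (labeling_of xs)(w \<mapsto> length xs + 1)"
proof -
  \<comment> \<open>\<open>map_of\<close> puts the appended pair on the left of \<open>++\<close>,
    the side of lower priority. Since \<open>w\<close> is fresh, the two domains are disjoint and
    the order does not matter.\<close>
  have "labeling_of (xs @ [w]) = [w \<mapsto> length xs + 1] ++ labeling_of xs"
    by (simp add: labeling_of_def upt_Suc_append[of "Suc 0" "Suc (length xs)"] del: upt_Suc)
  also have "\<dots> = labeling_of xs ++ [w \<mapsto> length xs + 1]"
    using assms by (intro map_add_comm) auto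
  finally show ?thesis by simp
qed

lemma labeling_of_nth:
  assumes "distinct xs" "k < length xs"
  shows "labeling_of xs (xs ! k) = Some (Suc k)"
  using assms by (simp add: labeling_of_def map_of_zip_nth del: upt_Suc)

text \<open>Each label gives back the position of its vertex. Without distinctness this fails:
  \<open>[a, a]\<close> and \<open>[a]\<close> have the same labeling.\<close>

lemma inj_on_labeling_of: "inj_on labeling_of {xs. distinct xs}"
proof (rule inj_onI, clarify)
  fix xs ys :: "'a list"
  assume dist: "distinct xs" "distinct ys" and eq: "labeling_of xs = labeling_of ys"
  have set_eq: "set xs = set ys"
    using arg_cong[OF eq, of dom] by simp
  then have len: "length xs = length ys"
    using dist by (metis distinct_card)
  show "xs = ys"
  proof (rule nth_equalityI[OF len])
    fix k assume k: "k < length xs"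
    then have "xs ! k \<in> set ys"
      using set_eq nth_mem by blast
    then obtain j where j: "j < length ys" "ys ! j = xs ! k"
      by (auto simp: in_set_conv_nth)
    then have "Suc j = Suc k"
      using labeling_of_nth[OF dist(1) k] labeling_of_nth[OF dist(2) j(1)] eq by simp
    with j show "xs ! k = ys ! k" by simp
  qed
qed

text \<open>The witness lists the labeled vertices as they were discovered. The current vertex
  always belongs to it, so a new vertex has an earlier neighbour, and a revisit leaves the list
  alone.\<close>

lemma rw_process_search_order:
  assumes "rw_process H v f i"
  shows "\<exists>xs. search_order H xs \<and> v \<in> set xs \<and> f = labeling_of xs \<and> i = length xs"
  using assms
proof (induction rule: rw_process.induct)
  case (start v)
  show ?case
    by (rule exI[of _ "[v]"]) (use start in \<open>auto simp: labeling_of_singleton intro: search_order.start\<close>)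
next
  case (visit_new v f i w)
  then obtain xs where xs: "search_order H xs" "v \<in> set xs" "f = labeling_of xs" "i = length xs"
    by blast
  with visit_new have "w \<notin> set xs" by simp
  with xs visit_new.hyps(3) show ?case
    by (intro exI[of _ "xs @ [w]"]) (auto simp: labeling_of_snoc intro: search_order.extend)
next
  case (revisit v f i w)
  then show ?case by (metis dom_labeling_of)
qed

text \<open>
  The labeled vertices are connected, so the walker can move freely among them; but only
  before the last label has been assigned, since the process then stops.
\<close>

lemma rw_process_move:
  assumes "symmetric H" "search_order H xs" "set xs \<subseteq> dom f" "\<not> verts H \<subseteq> dom f"
    and "x \<in> set xs" "y \<in> set xs" "rw_process H x f i"
  shows "rw_process H y f i"
  \<comment> \<open>The induction shortens \<open>xs\<close> while \<open>f\<close> stays fixed;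
    hence \<open>set xs\<close> is only assumed to be contained in \<open>dom f\<close>.\<close>
  using assms(2,3,5-7)
proof (induction arbitrary: x y rule: search_order.induct)
  case (start v)
  then show ?case by simp
next
  case (extend xs z w)
  have to_w: "rw_process H w f i" if "rw_process H z f i"
    using rw_process.revisit[OF that assms(4) extend.hyps(3)] extend.prems(1) by auto
  have from_w: "rw_process H z f i" if "rw_process H w f i"
    using rw_process.revisit[OF that assms(4) arcs_ends_symmetric[OF assms(1) extend.hyps(3)]]
      extend.prems(1) extend.hyps(2) by auto
  have sub: "set xs \<subseteq> dom f" using extend.prems(1) by simp
  \<comment> \<open>From \<open>w\<close> the walker steps back along the arc to \<open>z\<close>;
    from any other vertex the induction hypothesis leads to \<open>z\<close>. From there every
    target is reached likewise.\<close>
  have z: "rw_process H z f i"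
    using extend.IH[OF sub _ extend.hyps(2)] extend.prems from_w by auto
  show ?case
    using extend.IH[OF sub extend.hyps(2) _ z] to_w[OF z] extend.prems by auto
qed

text \<open>Before each extension the walker is moved to the earlier neighbour of the new vertex.
  The new vertex is itself still unlabeled, so the process has not stopped.\<close>

lemma search_order_rw_process:
  assumes "symmetric H" "wf_digraph H" "search_order H xs"
  shows "\<exists>v\<in>set xs. rw_process H v (labeling_of xs) (length xs)"
  using assms(3)
proof (induction rule: search_order.induct)
  case (start v)
  then have "rw_process H v (labeling_of [v]) 1"
    unfolding labeling_of_singleton by (rule rw_process.start)
  then show ?case by simp
next
  case (extend xs x w)
  then obtain v where v: "v \<in> set xs" "rw_process H v (labeling_of xs) (length xs)"
    by blast
  have "w \<in> verts H"
    using wf_digraph.adj_in_verts(2)[OF assms(2) extend.hyps(3)] .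
  then have unfinished: "\<not> verts H \<subseteq> dom (labeling_of xs)"
    using extend.hyps(4) by auto
  have "rw_process H x (labeling_of xs) (length xs)"
    using rw_process_move[OF assms(1) extend.hyps(1) _ unfinished v(1) extend.hyps(2) v(2)] by simp
  from rw_process.visit_new[OF this unfinished extend.hyps(3)] extend.hyps(4)
  have "rw_process H w (labeling_of (xs @ [w])) (length xs + 1)"
    unfolding labeling_of_snoc[OF extend.hyps(4)] by simp
  then show ?case by simp
qed

lemma num_rw_labelings_eq_card_search_orders:
  assumes "symmetric H" "wf_digraph H"
  shows "num_rw_labelings H = card {xs. search_order H xs \<and> set xs = verts H}"
proof -
  have "rw_labelings H = labeling_of ` {xs. search_order H xs \<and> set xs = verts H}"
  proof (intro equalityI subsetI)
    fix f assume "f \<in> rw_labelings H"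
    then obtain v i where f: "dom f = verts H" "rw_process H v f i"
      by (auto simp: rw_labelings_def)
    from rw_process_search_order[OF f(2)] f(1)
    show "f \<in> labeling_of ` {xs. search_order H xs \<and> set xs = verts H}" by auto
  next
    fix f assume "f \<in> labeling_of ` {xs. search_order H xs \<and> set xs = verts H}"
    then show "f \<in> rw_labelings H"
      using search_order_rw_process[OF assms] unfolding rw_labelings_def by force
  qed
  moreover have "inj_on labeling_of {xs. search_order H xs \<and> set xs = verts H}"
    by (rule inj_on_subset[OF inj_on_labeling_of]) (auto dest: search_order_distinct)
  ultimately show ?thesis
    by (simp add: num_rw_labelings_def card_image)
qed

section \<open>Permutations with prescribed restriction to a subset\<close>

lemma card_permutations_of_set_filter:
  assumes "finite V" "C \<subseteq> V" "Q \<subseteq> permutations_of_set C"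
  shows "card {xs \<in> permutations_of_set V. filter (\<lambda>x. x \<in> C) xs \<in> Q}
    = card Q * fact (card V - card C) * (card V choose card C)"
proof -
  let ?R = "permutations_of_set (V - C)"
  have fin: "finite C" "finite Q"
    using assms(1,2) finite_subset[OF assms(3)] by (auto intro: finite_subset)
  have Q: "set q = C" "distinct q" if "q \<in> Q" for q
    using that assms(3) by (auto simp: permutations_of_set_def)
  have R: "set p = V - C" "distinct p" if "p \<in> ?R" for p
    using that by (auto simp: permutations_of_set_def)
  have filter_C: "filter (\<lambda>x. x \<in> C) zs = q" and filter_R: "filter (\<lambda>x. x \<notin> C) zs = p"
    if "q \<in> Q" "p \<in> ?R" "zs \<in> shuffles q p" for q p zs
  proof -
    have "set q = C" "set q \<inter> set p = {}"
      using Q[OF that(1)] R[OF that(2)] by auto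
    with that show "filter (\<lambda>x. x \<in> C) zs = q" "filter (\<lambda>x. x \<notin> C) zs = p"
      using filter_shuffles_disjoint1[of q p zs] by simp_all
  qed
  \<comment> \<open>A permutation of \<open>V\<close> is a shuffle of its restrictions to
    \<open>C\<close> and \<open>V - C\<close>; the binomial coefficient will count the positions
    taken by \<open>C\<close>.\<close>
  have "{xs \<in> permutations_of_set V. filter (\<lambda>x. x \<in> C) xs \<in> Q}
      = (\<Union>(q, p) \<in> Q \<times> ?R. shuffles q p)" (is "?L = ?U")
  proof (intro equalityI subsetI)
    fix zs assume "zs \<in> ?L"
    moreover from this have "filter (\<lambda>x. x \<notin> C) zs \<in> ?R"
      by (auto simp: permutations_of_set_def)
    ultimately show "zs \<in> ?U"
      using partition_in_shuffles[of zs "\<lambda>x. x \<in> C"] by blast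
  next
    fix zs assume "zs \<in> ?U"
    then obtain q p where qp: "q \<in> Q" "p \<in> ?R" "zs \<in> shuffles q p" by blast
    note sets = Q[OF qp(1)] R[OF qp(2)]
    have "distinct zs"
      using distinct_disjoint_shuffles[OF sets(2,4) _ qp(3)] sets by auto
    then have "zs \<in> permutations_of_set V"
      using assms(2) set_shuffles[OF qp(3)] sets by auto
    with qp filter_C show "zs \<in> ?L" by simp
  qed
  moreover have "card ?U = (\<Sum>(q, p) \<in> Q \<times> ?R. card (shuffles q p))"
    unfolding case_prod_unfold
  proof (rule card_UN_disjoint)
    \<comment> \<open>Filtering recovers both words from a shuffle, so different pairs have disjoint
      sets of shuffles.\<close>
    have "z = z'" if "z \<in> Q \<times> ?R" "z' \<in> Q \<times> ?R"
      "zs \<in> shuffles (fst z) (snd z)" "zs \<in> shuffles (fst z') (snd z')" for z z' zs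
      using filter_C[of "fst z" "snd z" zs] filter_R[of "fst z" "snd z" zs]
        filter_C[of "fst z'" "snd z'" zs] filter_R[of "fst z'" "snd z'" zs] that
      by (simp add: mem_Times_iff prod_eq_iff)
    then show "\<forall>z\<in>Q \<times> ?R. \<forall>z'\<in>Q \<times> ?R. z \<noteq> z' \<longrightarrow>
        shuffles (fst z) (snd z) \<inter> shuffles (fst z') (snd z') = {}"
      by blast
  qed (use fin in auto)
  moreover have "\<dots> = (\<Sum>(q, p) \<in> Q \<times> ?R. card V choose card C)"
  proof (rule sum.cong, safe)
    fix q p assume "q \<in> Q" "p \<in> ?R"
    note qp = Q[OF this(1)] R[OF this(2)]
    then have "length q = card C" "length p = card V - card C"
      using distinct_card[of q] distinct_card[of p] assms(2) fin by (simp_all add: card_Diff_subset)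
    with qp show "card (shuffles q p) = card V choose card C"
      using card_disjoint_shuffles[of q p] card_mono[OF assms(1,2)] by auto
  qed
  moreover have "card ?R = fact (card V - card C)"
    using assms fin by (simp add: card_Diff_subset)
  ultimately show ?thesis
    by (simp add: card_cartesian_product case_prod_unfold)
qed

section \<open>Two bridged cliques: the orders that start in one of them\<close>

definition prefix_compatible :: "'a \<Rightarrow> 'a \<Rightarrow> 'a list \<Rightarrow> bool" where
  "prefix_compatible u v ys \<longleftrightarrow> ys = [] \<or> ys = [u] \<or> (\<exists>r. ys = u # v # r)"

lemma prefix_compatible_appendD: "prefix_compatible u v (xs @ ys) \<Longrightarrow> prefix_compatible u v xs"
  by (auto simp: prefix_compatible_def append_eq_Cons_conv)

locale bridged_cliques =
  fixes K :: "('a, 'b) pre_digraph" and A B :: "'a set" and u v :: 'a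
  assumes verts: "verts K = A \<union> B" and disjoint: "A \<inter> B = {}" and fin: "finite A" "finite B"
    and bridge: "u \<in> A" "v \<in> B"
    and adj: "x \<rightarrow>\<^bsub>K\<^esub> y \<longleftrightarrow>
      (x \<in> A \<and> y \<in> A \<and> x \<noteq> y) \<or> (x \<in> B \<and> y \<in> B \<and> x \<noteq> y) \<or> (x, y) \<in> {(u, v), (v, u)}"
begin

text \<open>Facts are proved for orders starting in \<open>A\<close>; this symmetry supplies those
  for orders starting in \<open>B\<close>.\<close>

lemma swap: "bridged_cliques K B A v u"
  using verts disjoint fin bridge adj by unfold_locales auto

text \<open>The restricted word must be comparable with \<open>[u, v]\<close> in the prefix order.
  This relaxes "begins with \<open>u, v\<close>" to unfinished orders, so that it can serve as an
  invariant. As \<open>u\<close> is not in \<open>B\<close>, a nonempty order of vertices of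
  \<open>K\<close> satisfying it starts in \<open>A\<close>.\<close>

definition respects_bridge :: "'a list \<Rightarrow> bool" where
  "respects_bridge xs \<longleftrightarrow> prefix_compatible u v (filter (\<lambda>x. x \<in> insert u B) xs)"

lemma respects_bridge_singleton: "w \<in> A \<Longrightarrow> respects_bridge [w]"
  using disjoint by (auto simp: respects_bridge_def prefix_compatible_def)

text \<open>Until \<open>u\<close> is discovered only \<open>A\<close> can be reached; after
  \<open>u\<close>, the first vertex reached in \<open>B\<close> must be \<open>v\<close>; after
  \<open>v\<close> nothing is constrained.\<close>

lemma respects_bridge_snoc:
  assumes "respects_bridge xs" "x \<in> set xs" "x \<rightarrow>\<^bsub>K\<^esub> w" "w \<notin> set xs"
  shows "respects_bridge (xs @ [w])"
proof -
  let ?ys = "filter (\<lambda>x. x \<in> insert u B) xs"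
  have ys: "z \<in> set ?ys \<longleftrightarrow> z \<in> set xs \<and> z \<in> insert u B" for z by auto
  consider "?ys = []" | "?ys = [u]" | r where "?ys = u # v # r"
    using assms(1) by (auto simp: respects_bridge_def prefix_compatible_def)
  then show ?thesis
  proof cases
    case 1
    then have "x \<notin> insert u B" using ys[of x] assms(2) by simp
    then have "w \<in> A" using assms(2,3) adj bridge by blast
    then show ?thesis using 1 disjoint by (auto simp: respects_bridge_def prefix_compatible_def)
  next
    case 2
    then have u: "u \<in> set xs" using ys[of u] by simp
    have "x \<notin> B" using 2 ys[of x] assms(2) bridge disjoint by auto
    then have "w \<in> A \<or> w = v" using assms(3) adj bridge by auto
    then show ?thesis using 2 u assms(4) disjoint by (auto simp: respects_bridge_def prefix_compatible_def)
  next
    case 3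
    then show ?thesis by (simp add: respects_bridge_def prefix_compatible_def)
  qed
qed

text \<open>Every later vertex has an earlier neighbour: in \<open>A\<close>, any earlier vertex of
  \<open>A\<close>, which is \<open>u\<close> as soon as the restricted word is nonempty; for
  \<open>v\<close>, the vertex \<open>u\<close>; for the rest of \<open>B\<close>, the vertex
  \<open>v\<close>.\<close>

lemma search_order_if_respects_bridge:
  assumes "xs \<noteq> []" "distinct xs" "set xs \<subseteq> verts K" "respects_bridge xs"
  shows "search_order K xs"
  using assms
proof (induction xs rule: rev_induct)
  case Nil
  then show ?case by simp
next
  case (snoc w xs)
  show ?case
  proof (cases "xs = []")
    case True
    then show ?thesis using snoc.prems by (simp add: search_order.start)
  next
    case False
    let ?ys = "filter (\<lambda>x. x \<in> insert u B) xs"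
    have ys: "z \<in> set ?ys \<Longrightarrow> z \<in> set xs" for z by auto
    have "respects_bridge xs"
      using snoc.prems(4) prefix_compatible_appendD by (fastforce simp: respects_bridge_def)
    with snoc False have so: "search_order K xs" by simp
    have w: "w \<notin> set xs" "w \<in> A \<union> B" using snoc.prems verts by auto
    have "\<exists>x\<in>set xs. x \<rightarrow>\<^bsub>K\<^esub> w"
    proof (cases "w \<in> A")
      case True
      have "\<exists>x\<in>set xs. x \<in> A"
      proof (cases "?ys = []")
        case True
        with False have "hd xs \<in> set xs" "hd xs \<notin> B" by (auto simp: filter_empty_conv)
        then show ?thesis using snoc.prems(3) verts by auto
      next
        case False
        then have "u \<in> set ?ys"
          using \<open>respects_bridge xs\<close> unfolding respects_bridge_def prefix_compatible_def
          by (metis list.set_intros(1))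
        then show ?thesis using bridge ys by blast
      qed
      with True w show ?thesis using adj by metis
    next
      case False
      with w have "w \<in> B" "w \<noteq> u" using bridge by auto
      then have "prefix_compatible u v (?ys @ [w])"
        using snoc.prems(4) by (simp add: respects_bridge_def)
      then consider "?ys = [u]" "w = v" | r where "?ys = u # v # r"
        using \<open>w \<noteq> u\<close> by (auto simp: prefix_compatible_def append_eq_Cons_conv)
      then show ?thesis
      proof cases
        case 1
        then show ?thesis using ys[of u] adj by auto
      next
        case 2
        then have "v \<in> set xs" using ys[of v] by simp
        then show ?thesis using adj \<open>w \<in> B\<close> bridge w by metis
      qed
    qed
    with so w show ?thesis by (auto intro: search_order.extend)
  qed
qed

section \<open>Counting the orders that start in one clique\<close>

definition bridge_orders :: "'a list set" where
  "bridge_orders = {xs \<in> permutations_of_set (A \<union> B).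
    filter (\<lambda>x. x \<in> insert u B) xs \<in> (\<lambda>r. u # v # r) ` permutations_of_set (B - {v})}"

text \<open>A complete order contains both \<open>u\<close> and \<open>v\<close>, which rules out
  the short words allowed by \<open>prefix_compatible\<close>. The explicit set of restrictions in
  \<open>bridge_orders\<close> is the form that the shuffle count needs.\<close>

lemma bridge_orders_iff:
  "xs \<in> bridge_orders \<longleftrightarrow> distinct xs \<and> set xs = A \<union> B \<and> respects_bridge xs"
proof (intro iffI)
  assume "xs \<in> bridge_orders"
  then show "distinct xs \<and> set xs = A \<union> B \<and> respects_bridge xs"
    by (auto simp: bridge_orders_def respects_bridge_def prefix_compatible_def dest: permutations_of_setD)
next
  assume xs: "distinct xs \<and> set xs = A \<union> B \<and> respects_bridge xs"
  let ?ys = "filter (\<lambda>x. x \<in> insert u B) xs"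
  have set_ys: "set ?ys = insert u B" and "distinct ?ys" using xs bridge by auto
  moreover have "u \<noteq> v" using bridge disjoint by auto
  ultimately obtain r where r: "?ys = u # v # r"
    using xs bridge unfolding respects_bridge_def prefix_compatible_def
    by (metis empty_iff empty_set insertCI set_ConsD)
  have "insert u (insert v (set r)) = insert u B" using set_ys unfolding r by simp
  moreover have "u \<noteq> v" "u \<notin> set r" "v \<notin> set r" "distinct r" "u \<notin> B"
    using \<open>distinct ?ys\<close> bridge disjoint unfolding r by auto
  ultimately have "r \<in> permutations_of_set (B - {v})"
    using bridge by (intro permutations_of_setI) auto
  then show "xs \<in> bridge_orders"
    using xs r by (auto simp: bridge_orders_def)
qed

text \<open>The shuffle count is applied with \<open>C = insert u B\<close>, of size
  \<open>card B + 1\<close>, leaving \<open>card A - 1\<close> vertices. An admissible restriction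
  is fixed by its tail, an order of \<open>B - {v}\<close>.\<close>

lemma card_bridge_orders:
  "card bridge_orders =
    fact (card A - 1) * fact (card B - 1) * ((card A + card B) choose (card B + 1))"
proof -
  let ?Q = "(\<lambda>r. u # v # r) ` permutations_of_set (B - {v})"
  have u: "u \<notin> B" using bridge disjoint by auto
  have "?Q \<subseteq> permutations_of_set (insert u B)"
  proof
    fix ys assume "ys \<in> ?Q"
    then obtain r where r: "ys = u # v # r" "set r = B - {v}" "distinct r"
      by (auto dest: permutations_of_setD)
    have "set ys = insert u B" unfolding r(1) using r(2) bridge by (simp add: insert_absorb)
    moreover have "distinct ys" unfolding r(1) using r(2,3) u bridge by auto
    ultimately show "ys \<in> permutations_of_set (insert u B)" by (rule permutations_of_setI)
  qed
  from card_permutations_of_set_filter[OF _ _ this, of "A \<union> B"]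
  have "card bridge_orders =
      card ?Q * fact (card (A \<union> B) - card (insert u B)) * (card (A \<union> B) choose card (insert u B))"
    using fin bridge by (auto simp: bridge_orders_def)
  moreover have "card ?Q = fact (card B - 1)"
    using fin bridge by (subst card_image) (auto simp: inj_on_def)
  ultimately show ?thesis
    using fin u disjoint by (simp add: card_Un_disjoint)
qed

end

section \<open>Combining the two starting cliques\<close>

sublocale bridged_cliques \<subseteq> swapped: bridged_cliques K B A v u
  by (rule swap)

context bridged_cliques
begin

text \<open>The clique of the first vertex decides which alternative holds, and extensions preserve
  it.\<close>

lemma search_order_respects_bridge:
  assumes "search_order K xs"
  shows "respects_bridge xs \<or> swapped.respects_bridge xs"
  using assms
proof (induction rule: search_order.induct)
  case (start w)
  then show ?case
    using verts respects_bridge_singleton swapped.respects_bridge_singleton by auto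
next
  case (extend xs x w)
  then show ?case
    using respects_bridge_snoc swapped.respects_bridge_snoc by blast
qed

lemma symmetric: "symmetric K"
  unfolding symmetric_def by (rule symI) (auto simp: adj)

lemma search_orders_eq:
  "{xs. search_order K xs \<and> set xs = verts K} = bridge_orders \<union> swapped.bridge_orders"
proof (intro set_eqI iffI)
  fix xs assume "xs \<in> {xs. search_order K xs \<and> set xs = verts K}"
  then show "xs \<in> bridge_orders \<union> swapped.bridge_orders"
    using search_order_respects_bridge search_order_distinct verts swapped.verts
    by (simp add: bridge_orders_iff swapped.bridge_orders_iff) blast
next
  fix xs assume "xs \<in> bridge_orders \<union> swapped.bridge_orders"
  then have xs: "distinct xs" "set xs = verts K" "respects_bridge xs \<or> swapped.respects_bridge xs"
    using verts swapped.verts by (auto simp: bridge_orders_iff swapped.bridge_orders_iff)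
  moreover from this have "xs \<noteq> []" using verts bridge by auto
  ultimately show "xs \<in> {xs. search_order K xs \<and> set xs = verts K}"
    using search_order_if_respects_bridge swapped.search_order_if_respects_bridge by auto
qed

text \<open>Restricting further to \<open>{u, v}\<close> shows \<open>u\<close> before
  \<open>v\<close> in one family and \<open>v\<close> before \<open>u\<close> in the other.\<close>

lemma bridge_orders_disjoint: "bridge_orders \<inter> swapped.bridge_orders = {}"
proof -
  have False
    if "filter (\<lambda>x. x \<in> insert u B) xs = u # v # r"
      and "filter (\<lambda>x. x \<in> insert v A) xs = v # u # s" for xs r s
  proof -
    have "u \<noteq> v" using bridge disjoint by auto
    have "filter (\<lambda>x. x \<in> {u, v}) (u # v # r) = filter (\<lambda>x. x \<in> {u, v}) xs"
      unfolding that(1)[symmetric] filter_filter using bridge by (intro filter_cong) auto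
    moreover have "filter (\<lambda>x. x \<in> {u, v}) (v # u # s) = filter (\<lambda>x. x \<in> {u, v}) xs"
      unfolding that(2)[symmetric] filter_filter using bridge by (intro filter_cong) auto
    ultimately have "u # filter (\<lambda>x. x \<in> {u, v}) (v # r) = v # filter (\<lambda>x. x \<in> {u, v}) (u # s)"
      by simp
    with \<open>u \<noteq> v\<close> show False by blast
  qed
  then show ?thesis
    unfolding bridge_orders_def swapped.bridge_orders_def by blast
qed

lemma num_rw_labelings:
  assumes "wf_digraph K"
  shows "num_rw_labelings K = fact (card A - 1) * fact (card B - 1) *
    (((card A + card B) choose (card B + 1)) + ((card A + card B) choose (card A + 1)))"
proof -
  have "finite bridge_orders" "finite swapped.bridge_orders"
    by (simp_all add: bridge_orders_def swapped.bridge_orders_def)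
  then have "num_rw_labelings K = card bridge_orders + card swapped.bridge_orders"
    using bridge_orders_disjoint
    by (simp add: num_rw_labelings_eq_card_search_orders[OF symmetric assms]
        search_orders_eq card_Un_disjoint)
  then show ?thesis
    by (simp add: card_bridge_orders swapped.card_bridge_orders algebra_simps)
qed

end

theorem theorem3:
  fixes G H :: "'a pair_pre_digraph" and u v :: 'a and m n :: nat
  assumes "m \<ge> 1" and "n \<ge> 1"
    and "complete_digraph m (with_proj G)" and "complete_digraph n (with_proj H)"
    and "pverts G \<inter> pverts H = {}"
    and "u \<in> pverts G" and "v \<in> pverts H"
  shows "num_rw_labelings (with_proj (bridge_join G u H v)) =
    fact (m - 1) * fact (n - 1) * (((m + n) choose (n + 1)) + ((m + n) choose (m + 1)))"
proof -
  have G: "finite (pverts G)" "card (pverts G) = m"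
      "parcs G = {(x, y). (x, y) \<in> pverts G \<times> pverts G \<and> x \<noteq> y}"
    and H: "finite (pverts H)" "card (pverts H) = n"
      "parcs H = {(x, y). (x, y) \<in> pverts H \<times> pverts H \<and> x \<noteq> y}"
    using assms(3,4) by (simp_all add: complete_digraph_pair_def)
  let ?K = "with_proj (bridge_join G u H v)"
  \<comment> \<open>The three sets of arcs united in \<open>bridge_join\<close> match the three
    disjuncts of the adjacency axiom.\<close>
  interpret bridged_cliques ?K "pverts G" "pverts H" u v
    using assms(5-7) G H by unfold_locales (auto simp: bridge_join_def)
  have "wf_digraph ?K"
    using assms(6,7) G(3) H(3) by unfold_locales (auto simp: bridge_join_def)
  then show ?thesis
    using num_rw_labelings G(2) H(2) by simp
qed

end
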